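(* Let $G$ be a connected graph with order $n(G)$ and let $H$ be any graph. Then $\mathrm{mp}(G \odot H) = n(G)\,\mathrm{mp}(H)$.
   Context: All graphs are finite, simple and undirected. The order of a graph is its number of vertices. The corona product $G \odot H$, where $V(G) = \{v_1,\dots,v_n\}$, is obtained from the disjoint union of $G$ and $n$ disjoint copies $H_1,\dots,H_n$ of $H$ by making $v_i$ adjacent to every vertex of $H_i$ for $1 \leq i \leq n$. A path $P$ in a graph is monophonic (induced) if the graph contains no edge between vertices that are non-consecutive on $P$. A set $M$ of vertices is a monophonic position set (mp-set) if no three vertices of $M$ lie on a common monophonic path; $\mathrm{mp}$ of a graph is the number of vertices in a largest mp-set.
   Formalization: The formal theorem assumes n(G) ≥ 2 and that H has at least one vertex: for G = H = K_1 the corona is K_2 with mp 2, not 1, and for H without vertices the corona is G, with mp(G) > 0. Order-one instances where the formula happens to hold are not covered. *)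

theory Defs
  imports "Graph_Theory.Graph_Theory"
begin

text \<open>
  A finite, simple, undirected graph is a \<^locale>\<open>pair_graph\<close>: every edge is represented by
  its two opposite arcs, and there are no loops.
\<close>

text \<open>
  Vertex \<open>Inl v\<close> is the vertex \<open>v\<close> of \<open>G\<close>, and \<open>Inr (v, x)\<close> is the vertex \<open>x\<close> of the copy of
  \<open>H\<close> attached to \<open>v\<close>.
\<close>
definition corona ::
    "'a pair_pre_digraph \<Rightarrow> 'b pair_pre_digraph \<Rightarrow> ('a + 'a \<times> 'b) pair_pre_digraph"
    (infixl "\<odot>" 70) where
  "G \<odot> H = \<lparr>
     pverts = Inl ` pverts G \<union> Inr ` (pverts G \<times> pverts H),
     parcs = {(Inl u, Inl v) | u v. (u, v) \<in> parcs G}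
       \<union> {(Inr (v, x), Inr (v, y)) | v x y. v \<in> pverts G \<and> (x, y) \<in> parcs H}
       \<union> {(Inl v, Inr (v, x)) | v x. v \<in> pverts G \<and> x \<in> pverts H}
       \<union> {(Inr (v, x), Inl v) | v x. v \<in> pverts G \<and> x \<in> pverts H} \<rparr>"

lemma pair_graph_corona:
  assumes "pair_graph G" and "pair_graph H"
  shows "pair_graph (G \<odot> H)"
proof -
  interpret G: pair_graph G by fact
  interpret H: pair_graph H by fact
  have fin: "finite (pverts (G \<odot> H))"
    by (simp add: corona_def)
  have wf: "parcs (G \<odot> H) \<subseteq> pverts (G \<odot> H) \<times> pverts (G \<odot> H)"
    by (auto simp: corona_def dest: G.wellformed' H.wellformed')
  have fina: "finite (parcs (G \<odot> H))"
    using wf fin by (meson finite_SigmaI finite_subset)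
  have symm: "sym (parcs (G \<odot> H))"
    by (rule symI) (auto simp: corona_def intro: G.arcs_symmetric H.arcs_symmetric)
  have irr: "fst e \<noteq> snd e" if "e \<in> parcs (G \<odot> H)" for e
    using that by (auto simp: corona_def dest: G.no_loops' H.no_loops')
  show ?thesis
    using wf fin fina symm irr by unfold_locales (auto simp: symmetric_def)
qed

definition monophonic_path :: "'a pair_pre_digraph \<Rightarrow> 'a list \<Rightarrow> bool" where
  "monophonic_path G p \<longleftrightarrow> vpath p G \<and>
     (\<forall>i j. i < length p \<and> j < length p \<and> Suc i < j \<longrightarrow> (p ! i, p ! j) \<notin> parcs G)"

definition mp_set :: "'a pair_pre_digraph \<Rightarrow> 'a set \<Rightarrow> bool" where
  "mp_set G M \<longleftrightarrow> M \<subseteq> pverts G \<and>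
     \<not> (\<exists>x\<in>M. \<exists>y\<in>M. \<exists>z\<in>M. x \<noteq> y \<and> y \<noteq> z \<and> x \<noteq> z \<and>
          (\<exists>p. monophonic_path G p \<and> {x, y, z} \<subseteq> set p))"

text \<open>The maximum is over a finite nonempty set whenever \<open>G\<close> has finitely many vertices.\<close>
definition mp :: "'a pair_pre_digraph \<Rightarrow> nat" where
  "mp G = Max (card ` {M. mp_set G M})"

text \<open>
  A set of at most two vertices is always an mp-set.  Hence \<open>mp (K\<^sub>1 \<odot> K\<^sub>1) = mp K\<^sub>2 = 2\<close>,
  whereas \<open>mp K\<^sub>1 = 1\<close>: the product formula for the corona fails if \<open>G\<close> has order one.
  It also fails if \<open>H\<close> has no vertices, since then \<open>G \<odot> H\<close> is a copy of \<open>G\<close>.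
\<close>
lemma mp_eq_card_verts:
  assumes "finite (pverts G)" and "card (pverts G) \<le> 2"
  shows "mp G = card (pverts G)"
proof -
  have "mp_set G (pverts G)"
  proof -
    have False if "x \<in> pverts G" "y \<in> pverts G" "z \<in> pverts G"
      "x \<noteq> y" "y \<noteq> z" "x \<noteq> z" for x y z
    proof -
      have "card {x, y, z} \<le> card (pverts G)"
        using that assms(1) by (intro card_mono) auto
      with that assms(2) show False by simp
    qed
    then show ?thesis by (auto simp: mp_set_def)
  qed
  moreover have sub: "{M. mp_set G M} \<subseteq> Pow (pverts G)"
    by (auto simp: mp_set_def)
  moreover have "finite {M. mp_set G M}"
    using sub assms(1) by (simp add: finite_subset)
  ultimately show ?thesis
    unfolding mp_def
    by (intro Max_eqI) (auto intro: card_mono[OF assms(1)])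
qed

lemma corona_formula_order_one:
  fixes K1 :: "unit pair_pre_digraph"
  defines "K1 \<equiv> \<lparr> pverts = {()}, parcs = {} \<rparr>"
  shows "pair_graph K1" and "Digraph_Component.connected (with_proj K1)"
    and "mp (K1 \<odot> K1) = 2" and "card (pverts K1) * mp K1 = 1"
proof -
  show "pair_graph K1"
    by unfold_locales (auto simp: K1_def symmetric_def)
  show "Digraph_Component.connected (with_proj K1)"
    by (simp add: connected_conv K1_def rtrancl_on_refl)
  have "pverts (K1 \<odot> K1) = {Inl (), Inr ((), ())}"
    by (auto simp: corona_def K1_def)
  then show "mp (K1 \<odot> K1) = 2"
    by (simp add: mp_eq_card_verts)
  show "card (pverts K1) * mp K1 = 1"
    by (simp add: mp_eq_card_verts K1_def)
qed

end

theory Submission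
  imports Defs
begin

text \<open>
  An induced path through \<open>Inl v\<close> that meets the copy of \<open>H\<close> at \<open>v\<close> can only meet it in endpoints
  of the path, because \<open>Inl v\<close> is adjacent to the whole copy; an induced path that meets the copy
  but avoids \<open>Inl v\<close> stays inside the copy.  Hence a union of mp-sets of \<open>H\<close>, one in each copy, is
  an mp-set of the corona.  Conversely, let \<open>M\<close> be an mp-set of the corona.  Its trace on each copy
  is an mp-set of \<open>H\<close>.  If \<open>M\<close> contains \<open>Inl v\<close> and a vertex of the copy at \<open>v\<close>, then \<open>M\<close> has no
  vertex outside this branch, since a shortest path to such a vertex runs through \<open>Inl v\<close>; then
  \<open>card M \<le> 1 + mp H \<le> 2 * mp H\<close>.  Otherwise every branch contributes at most \<open>mp H\<close>.
\<close>

section \<open>Monophonic paths\<close>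

lemma set_vwalk_arcs_nth: "set (vwalk_arcs p) = (\<lambda>i. (p ! i, p ! Suc i)) ` {..<length p - 1}"
  by (induction p rule: vwalk_arcs.induct) (simp_all add: lessThan_Suc_eq_insert_0 image_image)

text \<open>Turns walks into positions: arcs between consecutive entries and absence of arcs between
  the others merge into one equivalence over index pairs, the form that all later arguments
  use.\<close>

lemma monophonic_path_iff:
  "monophonic_path G p \<longleftrightarrow> p \<noteq> [] \<and> set p \<subseteq> pverts G \<and> distinct p \<and>
     (\<forall>i j. i < j \<longrightarrow> j < length p \<longrightarrow> ((p ! i, p ! j) \<in> parcs G \<longleftrightarrow> j = Suc i))"
proof -
  have "set (vwalk_arcs p) \<subseteq> parcs G \<longleftrightarrow> (\<forall>i. Suc i < length p \<longrightarrow> (p ! i, p ! Suc i) \<in> parcs G)"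
    by (auto simp: set_vwalk_arcs_nth)
  then have "monophonic_path G p \<longleftrightarrow> p \<noteq> [] \<and> set p \<subseteq> pverts G \<and> distinct p \<and>
      (\<forall>i. Suc i < length p \<longrightarrow> (p ! i, p ! Suc i) \<in> parcs G) \<and>
      (\<forall>i j. i < length p \<and> j < length p \<and> Suc i < j \<longrightarrow> (p ! i, p ! j) \<notin> parcs G)"
    by (auto simp: monophonic_path_def vpath_def vwalk_def)
  also have "\<dots> \<longleftrightarrow> p \<noteq> [] \<and> set p \<subseteq> pverts G \<and> distinct p \<and>
      (\<forall>i j. i < j \<longrightarrow> j < length p \<longrightarrow> ((p ! i, p ! j) \<in> parcs G \<longleftrightarrow> j = Suc i))"
    by (metis Suc_lessI lessI less_trans less_not_refl)
  finally show ?thesis .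
qed

lemma monophonic_path_arc:
  assumes "monophonic_path G p" and "Suc i < length p"
  shows "(p ! i, p ! Suc i) \<in> parcs G"
  using assms by (simp add: monophonic_path_iff)

lemma (in pair_graph) monophonic_path_adj_iff:
  assumes "monophonic_path G p" and "i < length p" and "j < length p"
  shows "(p ! i, p ! j) \<in> parcs G \<longleftrightarrow> j = Suc i \<or> i = Suc j"
proof (cases i j rule: linorder_cases)
  case less
  with assms show ?thesis by (auto simp: monophonic_path_iff)
next
  case equal
  then show ?thesis using no_loops' by auto
next
  case greater
  with assms have "(p ! j, p ! i) \<in> parcs G \<longleftrightarrow> i = Suc j" by (auto simp: monophonic_path_iff)
  with greater show ?thesis using arcs_symmetric by auto
qed

text \<open>An injective map that preserves and reflects arcs embeds \<open>G\<close> as an induced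
  subgraph, so neither path arcs nor chords change. It will be applied to the embedding of
  \<open>H\<close> as a single copy.\<close>

lemma monophonic_path_map_iff:
  assumes "inj f" and "f ` pverts G \<subseteq> pverts G'" and "set p \<subseteq> pverts G"
    and "\<And>x y. (f x, f y) \<in> parcs G' \<longleftrightarrow> (x, y) \<in> parcs G"
  shows "monophonic_path G' (map f p) \<longleftrightarrow> monophonic_path G p"
  using assms by (auto simp: monophonic_path_iff distinct_map image_subset_iff inj_def inj_on_def subset_iff)

text \<open>Induction along a walk. If the next vertex \<open>z\<close> already lies on the induced
  path, cut the path there; otherwise cut it at the first neighbour of \<open>z\<close> and append
  \<open>z\<close>.\<close>

lemma (in pair_graph) monophonic_path_exists:
  assumes "(u, v) \<in> (parcs G)\<^sup>*" and "u \<in> pverts G"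
  shows "\<exists>p. monophonic_path G p \<and> hd p = u \<and> last p = v"
  using assms(1)
proof (induction rule: rtrancl_induct)
  case base
  have "monophonic_path G [u]" using assms(2) by (simp add: monophonic_path_iff)
  then show ?case by (intro exI[of _ "[u]"]) simp
next
  case (step y z)
  then obtain p where p: "monophonic_path G p" "hd p = u" "last p = y" by blast
  \<comment> \<open>Minimality makes the cut vertex the only neighbour of \<open>z\<close> on the
    kept prefix, so appending \<open>z\<close> creates no chord.\<close>
  let ?k = "LEAST k. k < length p \<and> (p ! k, z) \<in> parcs G"
  let ?q = "take (Suc ?k) p"
  have ne: "p \<noteq> []" using p by (simp add: monophonic_path_iff)
  \<comment> \<open>The last vertex \<open>y\<close> is adjacent to \<open>z\<close>, so the
    \<open>LEAST\<close> ranges over a nonempty set.\<close>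
  have ex: "length p - 1 < length p \<and> (p ! (length p - 1), z) \<in> parcs G"
    using ne p step by (simp add: last_conv_nth)
  have k: "?k < length p" "(p ! ?k, z) \<in> parcs G"
    using LeastI[of "\<lambda>k. k < length p \<and> (p ! k, z) \<in> parcs G", OF ex] by auto
  have least: "(p ! i, z) \<notin> parcs G" if "i < ?k" for i
    using not_less_Least[OF that] k that by auto
  have hd: "hd ?q = u" using ne p by simp
  show ?case
  proof (cases "z \<in> set p")
    case True
    then obtain j where j: "j < length p" "p ! j = z" by (auto simp: in_set_conv_nth)
    have "monophonic_path G (take (Suc j) p)"
      using p(1) ne by (auto simp: monophonic_path_iff dest: in_set_takeD)
    moreover have "last (take (Suc j) p) = z"
      using j by (simp add: take_Suc_conv_app_nth)
    ultimately show ?thesis using ne p by (intro exI[of _ "take (Suc j) p"]) simp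
  next
    case False
    have len: "length ?q = Suc ?k" using k by simp
    have "monophonic_path G (?q @ [z])"
      unfolding monophonic_path_iff
    proof (intro conjI allI impI)
      show "set (?q @ [z]) \<subseteq> pverts G"
        using p(1) k(2) by (auto simp: monophonic_path_iff dest: in_set_takeD wellformed')
      show "distinct (?q @ [z])"
        using p(1) False by (auto simp: monophonic_path_iff dest: in_set_takeD)
      fix i j assume ij: "i < j" "j < length (?q @ [z])"
      show "((?q @ [z]) ! i, (?q @ [z]) ! j) \<in> parcs G \<longleftrightarrow> j = Suc i"
      proof (cases "j = Suc ?k")
        case True
        with ij have "(?q @ [z]) ! i = p ! i" "(?q @ [z]) ! j = z"
          using len k by (auto simp: nth_append)
        then show ?thesis using True ij k(2) least[of i] by (cases "i = ?k") auto
      next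
        case False
        with ij have "(?q @ [z]) ! i = p ! i" "(?q @ [z]) ! j = p ! j" "j < length p"
          using len k by (auto simp: nth_append)
        then show ?thesis using p(1) ij by (auto simp: monophonic_path_iff)
      qed
    qed simp
    moreover have "hd (?q @ [z]) = u" using hd ne by (simp add: hd_append)
    ultimately show ?thesis by (intro exI[of _ "?q @ [z]"]) simp
  qed
qed

section \<open>Largest mp-sets\<close>

lemma mp_set_subset: "mp_set G M \<Longrightarrow> M \<subseteq> pverts G"
  by (simp add: mp_set_def)

lemma mp_setI:
  assumes "M \<subseteq> pverts G"
    and "\<And>x y z p. \<lbrakk>x \<in> M; y \<in> M; z \<in> M; x \<noteq> y; y \<noteq> z; x \<noteq> z; monophonic_path G p;
      x \<in> set p; y \<in> set p; z \<in> set p\<rbrakk> \<Longrightarrow> False"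
  shows "mp_set G M"
  unfolding mp_set_def using assms by (metis insert_subset)

lemma mp_setD:
  assumes "mp_set G M" and "x \<in> M" "y \<in> M" "z \<in> M" and "x \<noteq> y" "y \<noteq> z" "x \<noteq> z"
    and "monophonic_path G p" and "x \<in> set p" "y \<in> set p" "z \<in> set p"
  shows False
  using assms unfolding mp_set_def by (metis empty_subsetI insert_subset)

lemma finite_mp_sets: "finite (pverts G) \<Longrightarrow> finite {M. mp_set G M}"
  by (rule finite_subset[of _ "Pow (pverts G)"]) (auto simp: mp_set_def)

lemma card_le_mp: "finite (pverts G) \<Longrightarrow> mp_set G M \<Longrightarrow> card M \<le> mp G"
  unfolding mp_def by (intro Max_ge) (auto simp: finite_mp_sets)

lemma mp_attained:
  assumes "finite (pverts G)"
  obtains M where "mp_set G M" and "card M = mp G"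
proof -
  \<comment> \<open>The empty mp-set keeps the argument of \<open>Max\<close> nonempty.\<close>
  have "mp_set G {}" by (simp add: mp_set_def)
  then have "mp G \<in> card ` {M. mp_set G M}"
    unfolding mp_def using assms by (intro Max_in) (auto simp: finite_mp_sets)
  then show ?thesis using that by auto
qed

text \<open>Applied to \<open>H\<close>, this lets a single base vertex be charged against
  \<open>mp H\<close> in the upper bound; here the nonemptiness of \<open>H\<close> enters.\<close>

lemma mp_pos:
  assumes "finite (pverts G)" and "pverts G \<noteq> {}"
  shows "mp G \<ge> 1"
proof -
  from assms(2) obtain x where "x \<in> pverts G" by auto
  then have "mp_set G {x}" by (simp add: mp_set_def)
  from card_le_mp[OF assms(1) this] show ?thesis by simp
qed

section \<open>Monophonic paths in the corona\<close>

lemma pverts_corona: "pverts (G \<odot> H) = Inl ` pverts G \<union> Inr ` (pverts G \<times> pverts H)"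
  by (simp add: corona_def)

lemma corona_arc_simps [simp]:
  "(Inl u, Inl v) \<in> parcs (G \<odot> H) \<longleftrightarrow> (u, v) \<in> parcs G"
  "(Inl u, Inr (v, x)) \<in> parcs (G \<odot> H) \<longleftrightarrow> u = v \<and> v \<in> pverts G \<and> x \<in> pverts H"
  "(Inr (v, x), Inl u) \<in> parcs (G \<odot> H) \<longleftrightarrow> u = v \<and> v \<in> pverts G \<and> x \<in> pverts H"
  "(Inr (u, x), Inr (v, y)) \<in> parcs (G \<odot> H) \<longleftrightarrow> u = v \<and> v \<in> pverts G \<and> (x, y) \<in> parcs H"
  by (auto simp: corona_def)

text \<open>The base vertex \<open>Inl v\<close> is the only link between the copy at
  \<open>v\<close> and the rest of the corona.\<close>

lemma corona_arc_copyD: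
  assumes "(a, b) \<in> parcs (G \<odot> H)"
  shows "a = Inr (v, x) \<Longrightarrow> b = Inl v \<or> b \<in> range (\<lambda>y. Inr (v, y))"
    and "b = Inr (v, x) \<Longrightarrow> a = Inl v \<or> a \<in> range (\<lambda>y. Inr (v, y))"
  using assms by (auto simp: corona_def)

text \<open>Membership in \<open>S\<close> propagates from position 0 along the list, so a list that
  never crosses the boundary of \<open>S\<close> lies on one side of it.\<close>

lemma set_subset_if_consecutive:
  assumes "\<And>i. Suc i < length p \<Longrightarrow> p ! i \<in> S \<longleftrightarrow> p ! Suc i \<in> S" and "set p \<inter> S \<noteq> {}"
  shows "set p \<subseteq> S"
proof -
  have "i < length p \<Longrightarrow> p ! i \<in> S \<longleftrightarrow> p ! 0 \<in> S" for i
    by (induction i) (use assms(1) in auto)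
  with assms(2) show ?thesis by (metis disjoint_iff in_set_conv_nth subsetI)
qed

lemma monophonic_path_in_copy:
  assumes "monophonic_path (G \<odot> H) p" and "Inr (v, x) \<in> set p" and "Inl v \<notin> set p"
  shows "set p \<subseteq> range (\<lambda>y. Inr (v, y))"
proof (rule set_subset_if_consecutive)
  fix i assume i: "Suc i < length p"
  then have "p ! i \<noteq> Inl v" "p ! Suc i \<noteq> Inl v"
    using assms(3) by (metis nth_mem Suc_lessD)+
  with corona_arc_copyD[OF monophonic_path_arc[OF assms(1) i]]
  show "p ! i \<in> range (\<lambda>y. Inr (v, y)) \<longleftrightarrow> p ! Suc i \<in> range (\<lambda>y. Inr (v, y))"
    by blast
qed (use assms(2) in auto)

locale corona_graphs = G: pair_graph G + H: pair_graph H
  for G :: "'a pair_pre_digraph" and H :: "'b pair_pre_digraph"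
begin

sublocale corona: pair_graph "G \<odot> H"
  by (rule pair_graph_corona) unfold_locales

text \<open>If the copy vertex were inner, \<open>Inl v\<close> would be one of its two neighbours
  on the path. The other one would then lie in the copy too, hence be adjacent to
  \<open>Inl v\<close>, which gives a chord.\<close>

lemma copy_vertex_is_endpoint:
  assumes p: "monophonic_path (G \<odot> H) p" and "Inl v \<in> set p" and "Inr (v, x) \<in> set p"
  shows "Inr (v, x) \<in> {hd p, last p}"
proof (rule ccontr)
  assume not_end: "Inr (v, x) \<notin> {hd p, last p}"
  obtain i where i: "i < length p" "p ! i = Inr (v, x)"
    using assms(3) by (auto simp: in_set_conv_nth)
  obtain k where k: "k < length p" "p ! k = Inl v"
    using assms(2) by (auto simp: in_set_conv_nth)
  have inner: "0 < i" "Suc i < length p"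
  proof -
    have "p \<noteq> []" using i by auto
    with not_end i have "i \<noteq> 0" "i \<noteq> length p - 1"
      by (auto simp: hd_conv_nth last_conv_nth intro: ccontr)
    with i show "0 < i" "Suc i < length p" by auto
  qed
  have "set p \<subseteq> pverts (G \<odot> H)" using p by (simp add: monophonic_path_iff)
  then have vx: "v \<in> pverts G" "x \<in> pverts H"
    using assms(3) by (auto simp: pverts_corona)
  have ik: "k = Suc i \<or> i = Suc k"
    using corona.monophonic_path_adj_iff[OF p i(1) k(1)] i k vx by simp
  \<comment> \<open>the other neighbour on the path\<close>
  define m where "m = (if k = Suc i then i - 1 else Suc i)"
  have m: "m < length p" "m = Suc i \<or> i = Suc m" "m \<noteq> k" "\<not> (m = Suc k \<or> k = Suc m)"
    using ik inner i by (auto simp: m_def)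
  have "p ! m \<noteq> Inl v"
    using p k m by (metis monophonic_path_iff nth_eq_iff_index_eq)
  moreover have im: "(p ! i, p ! m) \<in> parcs (G \<odot> H)"
    using corona.monophonic_path_adj_iff[OF p i(1) m(1)] m(2) by simp
  ultimately obtain y where y: "p ! m = Inr (v, y)"
    using corona_arc_copyD(1)[OF im i(2)] by auto
  then have "y \<in> pverts H"
    using im i(2) H.wellformed' by auto
  \<comment> \<open>Positions \<open>k\<close> and \<open>m\<close> lie on the two sides of
    \<open>i\<close>, so this arc joins vertices two steps apart.\<close>
  then have "(p ! k, p ! m) \<in> parcs (G \<odot> H)"
    using k y vx by simp
  then show False
    using corona.monophonic_path_adj_iff[OF p k(1) m(1)] m(4) by simp
qed

section \<open>Transfer of mp-sets between \<open>H\<close> and its copies\<close>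

lemma monophonic_path_copy_iff:
  assumes "v \<in> pverts G" and "set p \<subseteq> pverts H"
  shows "monophonic_path (G \<odot> H) (map (\<lambda>x. Inr (v, x)) p) \<longleftrightarrow> monophonic_path H p"
  using assms by (intro monophonic_path_map_iff) (auto simp: inj_def pverts_corona)

text \<open>A path has only two endpoints, so of three chosen vertices on an induced path, one has
  its base vertex off the path. This confines the path to one copy, where it pulls back to an
  induced path of \<open>H\<close>.\<close>

lemma mp_set_copies:
  assumes "mp_set H N"
  shows "mp_set (G \<odot> H) (Inr ` (pverts G \<times> N))"
proof (rule mp_setI)
  show "Inr ` (pverts G \<times> N) \<subseteq> pverts (G \<odot> H)"
    using mp_set_subset[OF assms] by (auto simp: pverts_corona)
next
  let ?M = "Inr ` (pverts G \<times> N) :: ('a + 'a \<times> 'b) set"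
  fix a b c p
  assume abc: "a \<in> ?M" "b \<in> ?M" "c \<in> ?M" "a \<noteq> b" "b \<noteq> c" "a \<noteq> c"
    and p: "monophonic_path (G \<odot> H) p" and sub: "a \<in> set p" "b \<in> set p" "c \<in> set p"
  have "\<exists>v x. Inr (v, x) \<in> {a, b, c} \<and> Inl v \<notin> set p"
  proof (rule ccontr)
    assume "\<not> ?thesis"
    then have "{a, b, c} \<subseteq> {hd p, last p}"
      using abc sub copy_vertex_is_endpoint[OF p] by auto
    then have "card {a, b, c} \<le> card {hd p, last p}"
      by (intro card_mono) auto
    also have "\<dots> \<le> 2" by (simp add: card_insert_if)
    finally show False using abc by simp
  qed
  then obtain v x where vx: "Inr (v, x) \<in> {a, b, c}" "Inl v \<notin> set p" by blast
  then have v: "v \<in> pverts G" using abc by auto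
  let ?f = "\<lambda>y. Inr (v, y) :: 'a + 'a \<times> 'b"
  \<comment> \<open>One of the three vertices determines \<open>v\<close>, but the whole path is
    confined, so the other two lie in the same copy.\<close>
  have copy: "set p \<subseteq> range ?f"
    using monophonic_path_in_copy[OF p _ vx(2)] vx(1) sub by auto
  then obtain q where q: "p = map ?f q"
    using ex_map_conv[of p ?f] by auto
  have "set p \<subseteq> pverts (G \<odot> H)" using p by (simp add: monophonic_path_iff)
  then have "set q \<subseteq> pverts H" by (auto simp: q pverts_corona)
  with p v have path: "monophonic_path H q" by (simp add: q monophonic_path_copy_iff)
  have inj: "Inr (v, y) \<in> set p \<longleftrightarrow> y \<in> set q" for y by (auto simp: q)
  from copy sub obtain x y z where xyz: "a = ?f x" "b = ?f y" "c = ?f z" by blast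
  show False
    by (rule mp_setD[OF assms _ _ _ _ _ _ path, of x y z]) (use abc sub inj xyz in auto)
qed

text \<open>A copy is an induced subgraph, so a forbidden path of \<open>H\<close> through three
  trace vertices would lift to one through three vertices of \<open>M\<close>.\<close>

lemma mp_set_trace:
  assumes "mp_set (G \<odot> H) M" and "v \<in> pverts G"
  shows "mp_set H {x. Inr (v, x) \<in> M}"
proof (rule mp_setI)
  show "{x. Inr (v, x) \<in> M} \<subseteq> pverts H"
    using mp_set_subset[OF assms(1)] by (auto simp: pverts_corona)
next
  let ?N = "{x. Inr (v, x) \<in> M}"
  fix x y z p
  assume xyz: "x \<in> ?N" "y \<in> ?N" "z \<in> ?N" "x \<noteq> y" "y \<noteq> z" "x \<noteq> z"
    and p: "monophonic_path H p" and sub: "x \<in> set p" "y \<in> set p" "z \<in> set p"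
  have "set p \<subseteq> pverts H" using p by (simp add: monophonic_path_iff)
  then have "monophonic_path (G \<odot> H) (map (\<lambda>x. Inr (v, x)) p)"
    using p assms(2) by (simp add: monophonic_path_copy_iff)
  from mp_setD[OF assms(1) _ _ _ _ _ _ this, of "Inr (v, x)" "Inr (v, y)" "Inr (v, z)"]
  show False using xyz sub by auto
qed

section \<open>Upper bound for mp-sets of the corona\<close>

lemma corona_reachable:
  assumes "\<And>u v. u \<in> pverts G \<Longrightarrow> v \<in> pverts G \<Longrightarrow> (u, v) \<in> (parcs G)\<^sup>*"
    and "a \<in> pverts (G \<odot> H)" and "b \<in> pverts (G \<odot> H)"
  shows "(a, b) \<in> (parcs (G \<odot> H))\<^sup>*"
proof -
  have base: "(Inl u, Inl v) \<in> (parcs (G \<odot> H))\<^sup>*" if "(u, v) \<in> (parcs G)\<^sup>*" for u v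
    using that
    by (induction rule: rtrancl_induct) (auto intro: rtrancl.rtrancl_into_rtrancl)
  \<comment> \<open>Both directions are recorded, since one fact serves the start of the walk at
    \<open>a\<close> and its end at \<open>b\<close>.\<close>
  have to_base: "\<exists>u\<in>pverts G. (c, Inl u) \<in> (parcs (G \<odot> H))\<^sup>* \<and> (Inl u, c) \<in> (parcs (G \<odot> H))\<^sup>*"
    if "c \<in> pverts (G \<odot> H)" for c
    using that by (auto simp: pverts_corona intro!: r_into_rtrancl)
  from to_base[OF assms(2)] to_base[OF assms(3)] obtain u v
    where "u \<in> pverts G" "v \<in> pverts G"
      "(a, Inl u) \<in> (parcs (G \<odot> H))\<^sup>*" "(Inl v, b) \<in> (parcs (G \<odot> H))\<^sup>*"
    by blast
  with base[OF assms(1)] show ?thesis by (meson rtrancl_trans)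
qed

text \<open>An induced path from \<open>Inr (v, x)\<close> to a vertex of \<open>M\<close> outside
  the branch must leave the copy through \<open>Inl v\<close>, and so would contain three vertices
  of \<open>M\<close>.\<close>

lemma mp_set_subset_branch:
  assumes conn: "\<And>u v. u \<in> pverts G \<Longrightarrow> v \<in> pverts G \<Longrightarrow> (u, v) \<in> (parcs G)\<^sup>*"
    and M: "mp_set (G \<odot> H) M" and v: "Inl v \<in> M" and x: "Inr (v, x) \<in> M"
  shows "M \<subseteq> insert (Inl v) (range (\<lambda>y. Inr (v, y)))"
proof
  fix w assume w: "w \<in> M"
  show "w \<in> insert (Inl v) (range (\<lambda>y. Inr (v, y)))"
  proof (rule ccontr)
    assume out: "\<not> ?thesis"
    have "Inr (v, x) \<in> pverts (G \<odot> H)" "w \<in> pverts (G \<odot> H)"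
      using M x w mp_set_subset by auto
    from corona.monophonic_path_exists[OF corona_reachable[OF conn this] this(1)]
    obtain p where p: "monophonic_path (G \<odot> H) p" "hd p = Inr (v, x)" "last p = w"
      by blast
    then have "p \<noteq> []" by (simp add: monophonic_path_iff)
    with p have ends: "Inr (v, x) \<in> set p" "w \<in> set p" by (metis hd_in_set last_in_set)+
    have "Inl v \<in> set p"
      using monophonic_path_in_copy[OF p(1) ends(1)] ends(2) out by blast
    with mp_setD[OF M x v w _ _ _ p(1)] ends out show False by auto
  qed
qed

lemma card_mp_set_corona_le:
  assumes conn: "\<And>u v. u \<in> pverts G \<Longrightarrow> v \<in> pverts G \<Longrightarrow> (u, v) \<in> (parcs G)\<^sup>*"
    and order: "card (pverts G) \<ge> 2" and "pverts H \<noteq> {}"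
    and M: "mp_set (G \<odot> H) M"
  shows "card M \<le> card (pverts G) * mp H"
proof -
  have pos: "mp H \<ge> 1"
    using assms(3) H.pair_finite_verts by (rule mp_pos[rotated])
  let ?T = "\<lambda>v. {x. Inr (v, x) \<in> M}"
  let ?B = "\<lambda>v. M \<inter> insert (Inl v) (range (\<lambda>y. Inr (v, y)))"
  have trace: "card (?T v) \<le> mp H" "finite (?T v)" if "v \<in> pverts G" for v
    using mp_set_trace[OF M that] H.pair_finite_verts
    by (blast intro: card_le_mp finite_subset dest: mp_set_subset)+
  have copy: "M \<inter> range (\<lambda>y. Inr (v, y)) = (\<lambda>y. Inr (v, y)) ` ?T v" for v
    by auto
  have card_copy: "card (M \<inter> range (\<lambda>y. Inr (v, y))) \<le> mp H" if "v \<in> pverts G" for v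
    unfolding copy using card_image_le[OF trace(2)[OF that]] trace(1)[OF that] by (rule le_trans)
  have sub: "M \<subseteq> pverts (G \<odot> H)" using M by (rule mp_set_subset)
  show ?thesis
  proof (cases "\<exists>v x. Inl v \<in> M \<and> Inr (v, x) \<in> M")
    case True
    then obtain v x where vx: "Inl v \<in> M" "Inr (v, x) \<in> M" by blast
    then have v: "v \<in> pverts G" using sub by (auto simp: pverts_corona)
    have "M = insert (Inl v) (M \<inter> range (\<lambda>y. Inr (v, y)))"
      using mp_set_subset_branch[OF conn M vx] vx by blast
    then have "card M = card (insert (Inl v) (M \<inter> range (\<lambda>y. Inr (v, y))))"
      by (rule arg_cong)
    also have "\<dots> \<le> Suc (card (M \<inter> range (\<lambda>y. Inr (v, y))))"
      using finite_subset[OF sub corona.pair_finite_verts] by (simp add: card_insert_if)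
    \<comment> \<open>The extra base vertex is absorbed by \<open>1 \<le> mp H\<close>; the next
      step pays for the factor 2 with the order of \<open>G\<close>.\<close>
    also have "\<dots> \<le> 2 * mp H" using card_copy[OF v] pos by simp
    also have "\<dots> \<le> card (pverts G) * mp H" using order by (rule mult_le_mono1)
    finally show ?thesis .
  next
    case False
    \<comment> \<open>No branch mixes its base vertex with copy vertices in this case, so its share
      of \<open>M\<close> is either the base vertex alone or a trace on the copy.\<close>
    have branch: "card (?B v) \<le> mp H" if "v \<in> pverts G" for v
    proof (cases "Inl v \<in> M")
      case True
      with False have "?B v = {Inl v}" by auto
      with pos show ?thesis by simp
    next
      case False
      then show ?thesis using card_copy[OF that] by simp
    qed
    have "M = (\<Union>v\<in>pverts G. ?B v)"
      using sub by (fastforce simp: pverts_corona)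
    then have "card M = card (\<Union>v\<in>pverts G. ?B v)"
      by (rule arg_cong)
    also have "\<dots> \<le> (\<Sum>v\<in>pverts G. card (?B v))"
      using G.pair_finite_verts by (rule card_UN_le)
    also have "\<dots> \<le> card (pverts G) * mp H"
      using sum_bounded_above[of "pverts G" "\<lambda>v. card (?B v)" "mp H"] branch by simp
    finally show ?thesis .
  qed
qed

section \<open>The product formula\<close>

lemma mp_corona:
  assumes "\<And>u v. u \<in> pverts G \<Longrightarrow> v \<in> pverts G \<Longrightarrow> (u, v) \<in> (parcs G)\<^sup>*"
    and "card (pverts G) \<ge> 2" and "pverts H \<noteq> {}"
  shows "mp (G \<odot> H) = card (pverts G) * mp H"
proof (rule antisym)
  obtain M where "mp_set (G \<odot> H) M" "card M = mp (G \<odot> H)"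
    using mp_attained[OF corona.pair_finite_verts] .
  with card_mp_set_corona_le[OF assms] show "mp (G \<odot> H) \<le> card (pverts G) * mp H"
    by metis
  obtain N where N: "mp_set H N" "card N = mp H"
    using mp_attained[OF H.pair_finite_verts] .
  \<comment> \<open>The lower bound is witnessed by a largest mp-set of \<open>H\<close> repeated in
    every copy.\<close>
  have "card (Inr ` (pverts G \<times> N) :: ('a + 'a \<times> 'b) set) = card (pverts G) * mp H"
    using N(2) by (simp add: card_image card_cartesian_product)
  with card_le_mp[OF corona.pair_finite_verts mp_set_copies[OF N(1)]]
  show "card (pverts G) * mp H \<le> mp (G \<odot> H)" by simp
qed

end

text \<open>Connectivity is phrased through the symmetric closure of the arcs, which adds nothing
  when the arcs are already symmetric.\<close>

lemma (in pair_graph) connected_rtrancl: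
  assumes "Digraph_Component.connected (with_proj G)" and "u \<in> pverts G" and "v \<in> pverts G"
  shows "(u, v) \<in> (parcs G)\<^sup>*"
proof -
  have "(parcs G)\<^sup>s = parcs G" using arcs_symmetric by (auto simp: symcl_def)
  with assms show ?thesis by (auto simp: connected_conv dest: rtrancl_on_rtranclI)
qed

theorem proposition3p7:
  fixes G :: "'a pair_pre_digraph" and H :: "'b pair_pre_digraph"
  assumes "pair_graph G" and "Digraph_Component.connected (with_proj G)"
    and "card (pverts G) \<ge> 2"
    and "pair_graph H" and "pverts H \<noteq> {}"
  shows "mp (G \<odot> H) = card (pverts G) * mp H"
proof -
  interpret corona_graphs G H using assms by (intro corona_graphs.intro)
  show ?thesis using G.connected_rtrancl[OF assms(2)] assms(3,5) by (rule mp_corona)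
qed

end
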